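(* Let $(S,\cdot)$ be a left amenable semigroup. For every $A\subseteq S$, $$d^*(A)\le\sup\left\{\delta\ge0: \text{for every finite multiset }\mathfrak{F}\text{ in }S,\ \exists\,s\in S,\ |\mathfrak{F}\cap As^{-1}|\ge\delta|\mathfrak{F}|\right\}.$$ Moreover, for every left invariant mean $\lambda$ on $S$, every $\beta\in[0,\lambda(A)]$ and every finite multiset $\mathfrak{F}$ in $S$, the set $S_\beta(A,\mathfrak{F})=\{s\in S: |\mathfrak{F}\cap As^{-1}|\ge\beta|\mathfrak{F}|\}$ satisfies $\lambda(S_\beta(A,\mathfrak{F}))\ge(\lambda(A)-\beta)/(1-\beta)$; in particular $d^*(S_\beta(A,\mathfrak{F}))\ge (d^*(A)-\beta)/(1-\beta)$.
   Context: $(S,\cdot)$ is left amenable if it admits a left translation invariant mean: a positive linear functional $\lambda$ of norm $1$ on the bounded real functions on $S$ with $\lambda(x\mapsto f(sx))=\lambda(f)$ for all $s\in S$; write $\lambda(B)$ for $\lambda(\mathbb{1}_B)$. $d^*(A)=\sup\{\lambda(A)\}$ over all left invariant means. $As^{-1}=\{t\in S: ts\in A\}$. A finite multiset $\mathfrak{F}$ in $S$ is a finite support $F\subseteq S$ with a function $\mathfrak{F}:F\to\mathbb{N}$; $|\mathfrak{F}|=\sum_{f\in F}\mathfrak{F}(f)$ and $|\mathfrak{F}\cap B|=\sum_{f\in F\cap B}\mathfrak{F}(f)$. *)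

theory Defs
  imports "HOL-Analysis.Analysis" "HOL-Library.Multiset"
begin

text \<open>
  A functional on the bounded real functions on a semigroup is represented by a total HOL function
  on all real functions; only its values on bounded functions are constrained or used.
  The operator norm is taken in the extended reals, so that the equation \<open>norm = 1\<close> includes that
  the functional is bounded.
\<close>

definition is_mean :: "(('a \<Rightarrow> real) \<Rightarrow> real) \<Rightarrow> bool" where
  "is_mean m \<longleftrightarrow>
     (\<forall>f g. bounded (range f) \<longrightarrow> bounded (range g) \<longrightarrow> m (\<lambda>x. f x + g x) = m f + m g) \<and>
     (\<forall>c f. bounded (range f) \<longrightarrow> m (\<lambda>x. c * f x) = c * m f) \<and>
     (\<forall>f. bounded (range f) \<longrightarrow> (\<forall>x. 0 \<le> f x) \<longrightarrow> 0 \<le> m f) \<and>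
     (SUP f\<in>{f. \<forall>x. \<bar>f x\<bar> \<le> 1}. ereal \<bar>m f\<bar>) = 1"

definition left_invariant_mean :: "(('a::semigroup_mult \<Rightarrow> real) \<Rightarrow> real) \<Rightarrow> bool" where
  "left_invariant_mean m \<longleftrightarrow>
     is_mean m \<and> (\<forall>s f. bounded (range f) \<longrightarrow> m (\<lambda>x. f (s * x)) = m f)"

definition left_amenable :: "'a::semigroup_mult itself \<Rightarrow> bool" where
  "left_amenable _ \<longleftrightarrow> (\<exists>m :: ('a \<Rightarrow> real) \<Rightarrow> real. left_invariant_mean m)"

definition mean_of_set :: "(('a \<Rightarrow> real) \<Rightarrow> real) \<Rightarrow> 'a set \<Rightarrow> real" where
  "mean_of_set m B = m (indicator B)"

text \<open>
  The supremum is over a nonempty set if the semigroup is left amenable, and over a subset of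
  \<open>{0..1}\<close> in any case.
\<close>

definition upper_density :: "'a::semigroup_mult set \<Rightarrow> real" where
  "upper_density A = Sup {mean_of_set m A | m. left_invariant_mean m}"

definition right_quotient :: "'a::semigroup_mult set \<Rightarrow> 'a \<Rightarrow> 'a set" where
  "right_quotient A s = {t. t * s \<in> A}"

definition mset_count_in :: "'a multiset \<Rightarrow> 'a set \<Rightarrow> nat" where
  "mset_count_in F B = (\<Sum>f \<in> set_mset F \<inter> B. count F f)"

definition S_set :: "real \<Rightarrow> 'a::semigroup_mult set \<Rightarrow> 'a multiset \<Rightarrow> 'a set" where
  "S_set \<beta> A F = {s. real (mset_count_in F (right_quotient A s)) \<ge> \<beta> * real (size F)}"

end

theory Submission
  imports Defs
begin

text \<open>
  By left invariance, the bounded function \<open>s \<mapsto> |F \<inter> As\<inverse>|\<close>, being a sum of left translates of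
  the indicator of \<open>A\<close>, has mean \<open>|F| \<lambda>(A)\<close>. It is at most \<open>|F|\<close> everywhere, and at most
  \<open>\<beta>|F|\<close> off \<open>S\<^sub>\<beta>(A, F)\<close>, so \<open>\<lambda>(A) \<le> \<beta> + (1 - \<beta>) \<lambda>(S\<^sub>\<beta>(A, F))\<close>. In particular
  \<open>S\<^sub>\<beta>(A, F)\<close> is nonempty for \<open>\<beta> < \<lambda>(A)\<close>, which bounds the density of \<open>A\<close>.
\<close>

section \<open>Boundedness of the functions to which a mean is applied\<close>

lemma bounded_range_realI:
  fixes f :: "'a \<Rightarrow> real"
  assumes "\<And>x. \<bar>f x\<bar> \<le> C"
  shows "bounded (range f)"
  using assms by (auto simp: bounded_iff)

lemma bounded_range_indicator: "bounded (range (indicator B :: 'a \<Rightarrow> real))"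
  by (rule bounded_range_realI[where C = 1]) (simp add: indicator_def)

lemma bounded_range_add:
  fixes f g :: "'a \<Rightarrow> real"
  assumes "bounded (range f)" "bounded (range g)"
  shows "bounded (range (\<lambda>x. f x + g x))"
  using bounded_plus_comp[OF assms] .

lemma bounded_range_cmult:
  fixes f :: "'a \<Rightarrow> real"
  assumes "bounded (range f)"
  shows "bounded (range (\<lambda>x. c * f x))"
  using bounded_scaling[OF assms, of c] by (simp add: image_image)

section \<open>Monotonicity and normalisation of means\<close>

lemma mean_add:
  assumes "is_mean m" "bounded (range f)" "bounded (range g)"
  shows "m (\<lambda>x. f x + g x) = m f + m g"
  using assms by (simp add: is_mean_def)

lemma mean_cmult:
  assumes "is_mean m" "bounded (range f)"
  shows "m (\<lambda>x. c * f x) = c * m f"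
  using assms by (simp add: is_mean_def)

text \<open>Positivity is applied to the difference of \<open>g\<close> and \<open>f\<close>,
  written with the factor \<open>- 1\<close> so that additivity and homogeneity evaluate its
  mean.\<close>

lemma mean_mono:
  assumes m: "is_mean m" and f: "bounded (range f)" and g: "bounded (range g)"
    and le: "\<And>x. f x \<le> g x"
  shows "m f \<le> m g"
proof -
  have d: "bounded (range (\<lambda>x. g x + (- 1) * f x))"
    by (intro bounded_range_add bounded_range_cmult f g)
  have "0 \<le> m (\<lambda>x. g x + (- 1) * f x)"
    using m d le unfolding is_mean_def by auto
  also have "\<dots> = m g + (- 1) * m f"
    using mean_add[OF m g bounded_range_cmult[OF f, of "- 1"]] mean_cmult[OF m f, of "- 1"]
    by simp
  finally show ?thesis by simp
qed

text \<open>A positive functional attains its norm at the constant 1: if \<open>f\<close> lies in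
  the unit ball, then both \<open>f\<close> and its negative are at most 1 pointwise, so
  monotonicity bounds the absolute value of \<open>m f\<close> by \<open>m (\<lambda>_. 1)\<close>.
  Norm one thus becomes the usual normalisation.\<close>

lemma mean_one:
  assumes m: "is_mean m"
  shows "m (\<lambda>_. 1) = 1"
proof (rule antisym)
  have SUP: "(SUP f\<in>{f. \<forall>x. \<bar>f x\<bar> \<le> 1}. ereal \<bar>m f\<bar>) = 1"
    using m by (simp add: is_mean_def)
  have "ereal \<bar>m (\<lambda>_. 1)\<bar> \<le> 1"
    unfolding SUP[symmetric] by (rule SUP_upper) simp
  then show "m (\<lambda>_. 1) \<le> 1" by simp
  have bd1: "bounded (range (\<lambda>_::'a. 1::real))"
    by (rule bounded_range_realI[where C = 1]) simp
  have "\<bar>m f\<bar> \<le> m (\<lambda>_. 1)" if f: "\<forall>x. \<bar>f x\<bar> \<le> 1" for f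
  proof -
    have bdf: "bounded (range f)"
      using f by (auto intro: bounded_range_realI)
    have "m f \<le> m (\<lambda>_. 1)"
      using f by (intro mean_mono[OF m bdf bd1]) (simp add: abs_le_iff)
    moreover have "- 1 * m f \<le> m (\<lambda>_. 1)"
      unfolding mean_cmult[OF m bdf, symmetric]
      using f by (intro mean_mono[OF m bounded_range_cmult[OF bdf] bd1]) (simp add: abs_le_iff)
    ultimately show ?thesis by simp
  qed
  then have "(SUP f\<in>{f. \<forall>x. \<bar>f x\<bar> \<le> 1}. ereal \<bar>m f\<bar>) \<le> ereal (m (\<lambda>_. 1))"
    by (intro SUP_least) simp
  then show "1 \<le> m (\<lambda>_. 1)"
    by (simp add: SUP one_ereal_def)
qed

lemma mean_const:
  assumes "is_mean m"
  shows "m (\<lambda>_. c) = c"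
  using mean_cmult[OF assms, of "\<lambda>_. 1" c] mean_one[OF assms]
  by (simp add: bounded_range_realI[where C = 1])

lemma mean_of_set_nonneg:
  assumes "is_mean m"
  shows "0 \<le> mean_of_set m B"
  using assms bounded_range_indicator[of B] by (simp add: is_mean_def mean_of_set_def)

lemma mean_of_set_le_one:
  assumes "is_mean m"
  shows "mean_of_set m B \<le> 1"
proof -
  have "m (indicator B) \<le> m (\<lambda>_. 1)"
    by (rule mean_mono[OF assms bounded_range_indicator bounded_range_realI[where C = 1]])
      (auto simp: indicator_def)
  then show ?thesis
    by (simp add: mean_of_set_def mean_one[OF assms])
qed

section \<open>Counts of a multiset in right quotients and their means\<close>

lemma mset_count_in_eq_size: "mset_count_in F B = size {#x \<in># F. x \<in> B#}"
  by (simp add: mset_count_in_def size_multiset_overloaded_eq Int_def)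

lemma mset_count_in_le_size: "mset_count_in F B \<le> size F"
  by (simp add: mset_count_in_eq_size size_filter_mset_lesseq)

lemma mset_count_in_add_mset:
  "real (mset_count_in (add_mset t F) B) = indicator B t + real (mset_count_in F B)"
  by (simp add: mset_count_in_eq_size)

lemma bounded_range_mset_count_in: "bounded (range (\<lambda>s. real (mset_count_in F (B s))))"
  by (rule bounded_range_realI[where C = "real (size F)"]) (simp add: mset_count_in_le_size)

text \<open>Induction on \<open>F\<close>: since \<open>t\<close> lies in the right quotient by
  \<open>s\<close> exactly when \<open>t * s\<close> lies in \<open>A\<close>, a new element
  \<open>t\<close> contributes the left translate by \<open>t\<close> of the indicator of
  \<open>A\<close>, whose mean is that of \<open>A\<close> by invariance.\<close>

lemma mean_mset_count_in_right_quotient: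
  assumes "left_invariant_mean m"
  shows "m (\<lambda>s. real (mset_count_in F (right_quotient A s))) = real (size F) * mean_of_set m A"
proof (induction F)
  case empty
  then show ?case
    using assms by (simp add: mset_count_in_eq_size mean_const left_invariant_mean_def)
next
  case (add t F)
  have m: "is_mean m" and inv: "m (\<lambda>s. indicator A (t * s)) = m (indicator A)"
    using assms bounded_range_indicator[of A] by (auto simp: left_invariant_mean_def)
  have "m (\<lambda>s. real (mset_count_in (add_mset t F) (right_quotient A s)))
      = m (\<lambda>s. indicator A (t * s) + real (mset_count_in F (right_quotient A s)))"
    by (simp add: mset_count_in_add_mset right_quotient_def indicator_def)
  also have "\<dots> = m (\<lambda>s. indicator A (t * s)) + m (\<lambda>s. real (mset_count_in F (right_quotient A s)))"
    by (rule mean_add[OF m _ bounded_range_mset_count_in])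
      (rule bounded_range_realI[where C = 1], simp add: indicator_def)
  also have "\<dots> = real (size (add_mset t F)) * mean_of_set m A"
    by (simp add: inv add.IH mean_of_set_def algebra_simps)
  finally show ?case .
qed

text \<open>The mean is applied to a pointwise bound of the count and the result divided by the size
  of \<open>F\<close>. The product form stays meaningful at \<open>\<beta> = 1\<close>, where the
  quotient form degenerates.\<close>

lemma mean_of_set_le_S_set:
  fixes m :: "('a::semigroup_mult \<Rightarrow> real) \<Rightarrow> real"
  assumes "left_invariant_mean m" and "\<beta> \<le> 1"
  shows "mean_of_set m A \<le> \<beta> + (1 - \<beta>) * mean_of_set m (S_set \<beta> A F)"
proof (cases "F = {#}")
  \<comment> \<open>Here the size is 0 and cannot be cancelled, but every \<open>s\<close> satisfies
    the defining inequality, so the right-hand side is 1.\<close>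
  case True
  have m: "is_mean m" using assms by (simp add: left_invariant_mean_def)
  have "S_set \<beta> A F = UNIV" by (simp add: S_set_def True)
  then have "mean_of_set m (S_set \<beta> A F) = 1"
    by (simp add: mean_of_set_def indicator_def[abs_def] mean_one[OF m])
  then show ?thesis using mean_of_set_le_one[OF m] by simp
next
  case False
  let ?n = "real (size F)" and ?S = "S_set \<beta> A F"
  have m: "is_mean m" using assms by (simp add: left_invariant_mean_def)
  have bi: "bounded (range (\<lambda>s. ?n * (1 - \<beta>) * indicator ?S s :: real))"
    by (rule bounded_range_cmult[OF bounded_range_indicator])
  have bc: "bounded (range (\<lambda>_::'a. ?n * \<beta>))"
    by simp
  \<comment> \<open>On \<open>?S\<close> the right-hand side is \<open>?n\<close>, the trivial
    bound; off \<open>?S\<close> it is \<open>?n * \<beta>\<close>, which the count fails to reach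
    by definition of \<open>S_set\<close>.\<close>
  have le: "real (mset_count_in F (right_quotient A s)) \<le> ?n * \<beta> + ?n * (1 - \<beta>) * indicator ?S s" for s
    using mset_count_in_le_size[of F "right_quotient A s"]
    by (cases "s \<in> ?S") (auto simp: S_set_def algebra_simps)
  have "?n * mean_of_set m A = m (\<lambda>s. real (mset_count_in F (right_quotient A s)))"
    by (rule mean_mset_count_in_right_quotient[OF assms(1), symmetric])
  also have "\<dots> \<le> m (\<lambda>s. ?n * \<beta> + ?n * (1 - \<beta>) * indicator ?S s)"
    by (rule mean_mono[OF m bounded_range_mset_count_in bounded_range_add[OF bc bi] le])
  also have "\<dots> = ?n * (\<beta> + (1 - \<beta>) * mean_of_set m ?S)"
    unfolding mean_add[OF m bc bi] mean_cmult[OF m bounded_range_indicator] mean_const[OF m]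
    by (simp add: mean_of_set_def distrib_left)
  finally show ?thesis using False by (simp add: nonempty_has_size)
qed

lemma mean_of_set_S_set_ge:
  assumes "left_invariant_mean m" and "\<beta> \<le> 1"
  shows "(mean_of_set m A - \<beta>) / (1 - \<beta>) \<le> mean_of_set m (S_set \<beta> A F)"
proof (cases "\<beta> = 1")
  \<comment> \<open>Division by zero yields 0, so nonnegativity of the mean suffices.\<close>
  case True
  then show ?thesis
    using assms by (simp add: left_invariant_mean_def mean_of_set_nonneg)
next
  case False
  then show ?thesis
    using mean_of_set_le_S_set[OF assms, of A F] assms(2) by (simp add: divide_le_eq algebra_simps)
qed

section \<open>Passage from means to upper density\<close>

lemma mean_of_set_le_upper_density:
  assumes "left_invariant_mean m"
  shows "mean_of_set m A \<le> upper_density A"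
  unfolding upper_density_def
  using assms mean_of_set_le_one
  by (intro cSup_upper) (auto intro!: bdd_aboveI simp: left_invariant_mean_def)

text \<open>Left amenability makes the set of values nonempty, as \<open>cSup_least\<close> requires
  for the conditional supremum of reals.\<close>

lemma upper_density_le:
  fixes A :: "'a::semigroup_mult set"
  assumes "left_amenable TYPE('a)"
    and "\<And>m. left_invariant_mean m \<Longrightarrow> mean_of_set m A \<le> c"
  shows "upper_density A \<le> c"
  unfolding upper_density_def
  using assms by (intro cSup_least) (auto simp: left_amenable_def)

lemma upper_density_nonneg:
  fixes A :: "'a::semigroup_mult set"
  assumes "left_amenable TYPE('a)"
  shows "0 \<le> upper_density A"
proof -
  obtain m :: "('a \<Rightarrow> real) \<Rightarrow> real" where m: "left_invariant_mean m"
    using assms by (auto simp: left_amenable_def)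
  then have "0 \<le> mean_of_set m A"
    by (simp add: left_invariant_mean_def mean_of_set_nonneg)
  also note mean_of_set_le_upper_density[OF m]
  finally show ?thesis .
qed

text \<open>An empty set has mean 0, and the estimate would then force the mean of \<open>A\<close>
  down to at most \<open>\<beta>\<close>.\<close>

lemma S_set_nonempty:
  fixes A :: "'a::semigroup_mult set"
  assumes "left_invariant_mean m" and "\<beta> < mean_of_set m A"
  shows "S_set \<beta> A F \<noteq> {}"
proof
  assume "S_set \<beta> A F = {}"
  moreover have m: "is_mean m" using assms(1) by (simp add: left_invariant_mean_def)
  ultimately have "mean_of_set m (S_set \<beta> A F) = 0"
    by (simp add: mean_of_set_def indicator_def[abs_def] mean_const)
  then show False
    using mean_of_set_le_S_set[OF assms(1), of \<beta> A F] mean_of_set_le_one[OF m, of A] assms(2)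
    by simp
qed

text \<open>Replacing the mean of \<open>S_set \<beta> A F\<close> by its upper density makes the
  bound on \<open>mean_of_set m A\<close> independent of \<open>m\<close>; only then is the supremum
  over \<open>m\<close> taken.\<close>

lemma upper_density_S_set_ge:
  fixes A :: "'a::semigroup_mult set"
  assumes amen: "left_amenable TYPE('a)" and "\<beta> \<le> 1"
  shows "(upper_density A - \<beta>) / (1 - \<beta>) \<le> upper_density (S_set \<beta> A F)"
proof (cases "\<beta> = 1")
  case True
  then show ?thesis using upper_density_nonneg[OF amen] by simp
next
  case False
  have "mean_of_set m A \<le> \<beta> + (1 - \<beta>) * upper_density (S_set \<beta> A F)"
    if "left_invariant_mean m" for m
  proof -
    have "(1 - \<beta>) * mean_of_set m (S_set \<beta> A F) \<le> (1 - \<beta>) * upper_density (S_set \<beta> A F)"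
      using mean_of_set_le_upper_density[OF that] \<open>\<beta> \<le> 1\<close> by (intro mult_left_mono) auto
    then show ?thesis using mean_of_set_le_S_set[OF that \<open>\<beta> \<le> 1\<close>, of A F] by simp
  qed
  from upper_density_le[OF amen this] show ?thesis
    using False \<open>\<beta> \<le> 1\<close> by (simp add: divide_le_eq algebra_simps)
qed

text \<open>Each nonnegative \<open>\<beta>\<close> below the mean of \<open>A\<close> belongs to
  the set on the right, any element of \<open>S_set \<beta> A F\<close> being the required
  \<open>s\<close>. Letting \<open>\<beta>\<close> increase to the mean gives the bound.\<close>

lemma upper_density_le_Sup:
  fixes A :: "'a::semigroup_mult set"
  assumes amen: "left_amenable TYPE('a)"
  shows "upper_density A \<le>
           Sup {\<delta>::real. \<delta> \<ge> 0 \<and>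
             (\<forall>F :: 'a multiset. \<exists>s. real (mset_count_in F (right_quotient A s)) \<ge> \<delta> * real (size F))}"
    (is "_ \<le> Sup ?D")
proof (rule upper_density_le[OF amen])
  fix m :: "('a \<Rightarrow> real) \<Rightarrow> real"
  assume m: "left_invariant_mean m"
  have "bdd_above ?D"
  proof (rule bdd_aboveI)
    fix \<delta> assume "\<delta> \<in> ?D"
    \<comment> \<open>A one-element multiset already forces \<open>\<delta> \<le> 1\<close>, its
      count being at most 1; \<open>undefined\<close> merely names some element.\<close>
    then obtain s where "\<delta> * real (size {#undefined :: 'a#})
        \<le> real (mset_count_in {#undefined#} (right_quotient A s))" by blast
    then show "\<delta> \<le> 1"
      using mset_count_in_le_size[of "{#undefined#}" "right_quotient A s"] by simp
  qed
  note upper = cSup_upper[OF _ this]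
  \<comment> \<open>This serves the negative \<open>\<beta>\<close>, which \<open>dense_le\<close>
    also produces and which are not in \<open>?D\<close>.\<close>
  have "0 \<le> Sup ?D" by (rule upper) simp
  show "mean_of_set m A \<le> Sup ?D"
  proof (rule dense_le)
    fix \<beta> assume \<beta>: "\<beta> < mean_of_set m A"
    show "\<beta> \<le> Sup ?D"
    proof (cases "0 \<le> \<beta>")
      case True
      then show ?thesis
        using S_set_nonempty[OF m \<beta>] by (intro upper) (auto simp: S_set_def)
    next
      case False
      then show ?thesis using \<open>0 \<le> Sup ?D\<close> by simp
    qed
  qed
qed

theorem theorem3p2:
  fixes A :: "'a::semigroup_mult set"
  assumes "left_amenable TYPE('a)"
  shows "upper_density A \<le>
           Sup {\<delta>::real. \<delta> \<ge> 0 \<and>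
             (\<forall>F :: 'a multiset. \<exists>s. real (mset_count_in F (right_quotient A s)) \<ge> \<delta> * real (size F))}
       \<and> (\<forall>m \<beta> (F :: 'a multiset).
             left_invariant_mean m \<and> \<beta> \<in> {0..mean_of_set m A} \<longrightarrow>
             mean_of_set m (S_set \<beta> A F) \<ge> (mean_of_set m A - \<beta>) / (1 - \<beta>))
       \<and> (\<forall>\<beta> (F :: 'a multiset).
             \<beta> \<in> {0..upper_density A} \<longrightarrow>
             upper_density (S_set \<beta> A F) \<ge> (upper_density A - \<beta>) / (1 - \<beta>))"
proof (intro conjI allI impI)
  fix m :: "('a \<Rightarrow> real) \<Rightarrow> real" and \<beta> and F :: "'a multiset"
  assume *: "left_invariant_mean m \<and> \<beta> \<in> {0..mean_of_set m A}"
  then have "\<beta> \<le> 1"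
    using mean_of_set_le_one[of m A] by (auto simp: left_invariant_mean_def)
  with * show "mean_of_set m (S_set \<beta> A F) \<ge> (mean_of_set m A - \<beta>) / (1 - \<beta>)"
    by (intro mean_of_set_S_set_ge) auto
next
  fix \<beta> and F :: "'a multiset"
  assume "\<beta> \<in> {0..upper_density A}"
  \<comment> \<open>This turns the given range of \<open>\<beta>\<close> into
    \<open>\<beta> \<le> 1\<close>, the form in which the estimate was proved.\<close>
  moreover have "upper_density A \<le> 1"
    by (intro upper_density_le[OF assms] mean_of_set_le_one) (simp add: left_invariant_mean_def)
  ultimately show "upper_density (S_set \<beta> A F) \<ge> (upper_density A - \<beta>) / (1 - \<beta>)"
    by (intro upper_density_S_set_ge[OF assms]) auto
qed (rule upper_density_le_Sup[OF assms])

end
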